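(* Let $(\mathbb{X},\mathbb{0},\mathbb{1},\oplus,\otimes)$ be a linearly ordered radicable idempotent semifield. Let $p_{ij}\in\mathbb{Q}$ and $a_i,g_j,h_j\in\mathbb{X}$ be such that $a_i\neq\mathbb{0}$, $h_j\neq\mathbb{0}$ and $g_j\leq h_j$ for all $i=1,\ldots,M$ and $j=1,\ldots,N$. Then the problem (A) of finding nonzero $x_1,\ldots,x_N\in\mathbb{X}$ that give $$\min_{x_1,\ldots,x_N}\ \bigoplus_{i=1}^{M}a_i x_1^{p_{i1}}\cdots x_N^{p_{iN}}\quad\text{s.t.}\quad g_j\leq x_j\leq h_j,\quad j=1,\ldots,N,$$ is equivalent to the problem (B) $$\min_{x_1,\ldots,x_{N-1}}\ \bigoplus_{i=1}^{M^2+M}b_i x_1^{q_{i1}}\cdots x_{N-1}^{q_{i,N-1}}\quad\text{s.t.}\quad g_j\leq x_j\leq h_j,\quad j=1,\ldots,N-1,$$ together with the double inequality $$\bigoplus_{i=1}^{M}c_i x_1^{r_{i1}}\cdots x_{N-1}^{r_{i,N-1}}\oplus g_N\ \leq\ x_N\ \leq\ \left(\bigoplus_{i=1}^{M}d_i x_1^{s_{i1}}\cdots x_{N-1}^{s_{i,N-1}}\oplus h_N^{-1}\right)^{-1},$$ where empty products are interpreted as $\mathbb{1}$, and for all $i,k=1,\ldots,M$ and $j=1,\ldots,N-1$ the following notation is used: $$q_{M(i-1)+k,j}=\begin{cases}-\dfrac{p_{ij}p_{kN}-p_{kj}p_{iN}}{p_{iN}-p_{kN}},&\text{if }p_{iN}<0\text{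 and }p_{kN}>0;\\ 0,&\text{otherwise};\end{cases}\qquad q_{M^2+i,j}=p_{ij};$$ $$r_{ij}=\begin{cases}-p_{ij}/p_{iN},&\text{if }p_{iN}<0;\\ 0,&\text{otherwise};\end{cases}\qquad s_{ij}=\begin{cases}p_{ij}/p_{iN},&\text{if }p_{iN}>0;\\ 0,&\text{otherwise};\end{cases}$$ $$b_{M(i-1)+k}=\begin{cases}a_i^{-\frac{p_{kN}}{p_{iN}-p_{kN}}}a_k^{\frac{p_{iN}}{p_{iN}-p_{kN}}},&\text{if }p_{iN}<0\text{ and }p_{kN}>0;\\ \mathbb{0},&\text{otherwise};\end{cases}\qquad b_{M^2+i}=(h_N^{-p_{iN}}\oplus g_N^{-p_{iN}})^{-1}a_i;$$ $$c_i=\begin{cases}\mu^{1/p_{iN}}a_i^{-1/p_{iN}},&\text{if }p_{iN}<0;\\ \mathbb{0},&\text{otherwise};\end{cases}\qquad d_i=\begin{cases}\mu^{-1/p_{iN}}a_i^{1/p_{iN}},&\text{if }p_{iN}>0;\\ \mathbb{0},&\text{otherwise};\end{cases}$$ and $\mu$ is the minimum of the objective function in problem (B).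
   Context: An idempotent semifield $(\mathbb{X},\mathbb{0},\mathbb{1},\oplus,\otimes)$ is a nonempty set $\mathbb{X}$ with addition $\oplus$, multiplication $\otimes$ and distinct elements $\mathbb{0},\mathbb{1}$ such that $(\mathbb{X},\mathbb{0},\oplus)$ is a commutative monoid with $x\oplus x=x$ for all $x$, $(\mathbb{X}\setminus\{\mathbb{0}\},\mathbb{1},\otimes)$ is an Abelian group, and $\otimes$ distributes over $\oplus$ (it is a semiring with idempotent addition and invertible multiplication). The sign $\otimes$ is omitted in formulas. The order is defined by: $x\leq y$ if and only if $x\oplus y=y$, so $x\geq\mathbb{0}$ for all $x$; minima are understood with respect to this order. "Linearly ordered" means that this partial order is a linear order. "Radicable" means that for each $a\in\mathbb{X}$ and each integer $n>0$ the equation $x^n=a$ has a unique solution $x\in\mathbb{X}$, so that rational powers are well defined. In both problems the unknowns range over nonzero elements of $\mathbb{X}$. All inverses and powers of elements of $\mathbb{X}$ are taken in the sense of the semifield multiplication: for nonzero $x$ and integers $m$, $n>0$, the power $x^{m/n}$ is the unique $y$ with $y^n=x^m$; $x^0=\mathbb{1}$ for nonzero $x$; and $\mathbb{0}^n=\mathbb{0}$ for positive integers $n$. The exponents $p_{ij},q_{ij},r_{ij},s_{ij}$ are ordinary rational numbers, computed with ordinary arithmetic. Under the condition $g_N\leq h_N$, the expression $(h_N^{-p}\oplus g_N^{-p})^{-1}$ equals $h_N^{p}$ if $p<0$, $\mathbb{1}$ if $p=0$, and $g_N^{p}$ if $p>0$.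
   Formalization: If all p_iN > 0 and g_N = 0, the semifield is assumed not to be {0,1} (there (A) has minimum 1 but (B) has minimum 0); and if μ = 0 with some p_iN > 0, where the powers of μ in d_i are undefined, the upper bound on x_N is read as 0. *)

theory Defs
  imports Complex_Main
begin

text \<open>
  Addition and multiplication of the semifield are written \<open>+\<close> and \<open>*\<close>, and its carrier is
  the whole type. The class \<^class>\<open>comm_semiring_1\<close> supplies the two commutative monoids,
  distributivity, absorption by \<open>0\<close>, and \<open>0 \<noteq> 1\<close>; closure of the nonzero elements under
  multiplication and inversion follows from the existence of inverses. The element \<open>inverse 0\<close>
  is left unspecified.
\<close>

class idempotent_semifield = comm_semiring_1 + inverse + order +
  assumes add_idem: "x + x = x"
    and mult_inverse: "x \<noteq> 0 \<Longrightarrow> x * inverse x = 1"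
    and divide_eq_mult_inverse: "x / y = x * inverse y"
    and le_iff_add_eq: "x \<le> y \<longleftrightarrow> x + y = y"

class linordered_idempotent_semifield = idempotent_semifield + linorder

class linordered_radicable_idempotent_semifield = linordered_idempotent_semifield +
  assumes radicable: "0 < n \<Longrightarrow> \<exists>!x. x ^ n = a"

text \<open>
  The definition uses the reduced fraction of the exponent; \<open>rpow_unique\<close> below shows that
  every other representation gives the same power. For the base \<open>0\<close>, positive exponents give
  \<open>0\<close>, the exponent \<open>0\<close> gives \<open>1\<close>, and negative exponents are meaningless.
\<close>

definition rpow :: "'a::linordered_radicable_idempotent_semifield \<Rightarrow> rat \<Rightarrow> 'a"  (infixr "rpow" 80)
  where "x rpow t = (case quotient_of t of (m, n) \<Rightarrow> THE y. y ^ nat n = x powi m)"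

lemma power_eq_imp_eq:
  fixes x y :: "'a::linordered_radicable_idempotent_semifield"
  assumes "0 < n" "x ^ n = y ^ n"
  shows "x = y"
  using radicable[OF assms(1), of "y ^ n"] assms(2) by blast

lemma powi_power:
  fixes x :: "'a::linordered_radicable_idempotent_semifield"
  shows "(x powi m) ^ k = x powi (m * int k)"
proof (cases "m \<ge> 0 \<or> k = 0")
  case True
  then show ?thesis
    by (auto simp: power_int_def power_mult[symmetric] nat_mult_distrib)
next
  case False
  then have m: "m < 0" and k: "0 < k" by auto
  have neg: "m * int k < 0" using m k by (simp add: mult_neg_pos)
  have "nat (- (m * int k)) = nat ((- m) * int k)" by simp
  also have "\<dots> = nat (- m) * k" using m by (subst nat_mult_distrib) auto
  finally have "x powi (m * int k) = inverse x ^ (nat (- m) * k)"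
    using neg by (simp add: power_int_def)
  then show ?thesis using m by (simp add: power_int_def power_mult)
qed

lemma rpow_unique:
  fixes x y :: "'a::linordered_radicable_idempotent_semifield"
  assumes "0 < n"
  shows "x rpow (of_int m / of_nat n) = y \<longleftrightarrow> y ^ n = x powi m"
proof -
  obtain m' n' where q: "quotient_of (of_int m / of_nat n) = (m', n')"
    by (cases "quotient_of (of_int m / of_nat n)")
  have n': "0 < n'" using quotient_of_denom_pos[OF q] .
  let ?y = "x rpow (of_int m / of_nat n)"
  have "\<exists>!y. y ^ nat n' = x powi m'" using n' by (intro radicable) simp
  then have y: "?y ^ nat n' = x powi m'"
    unfolding rpow_def q by simp (rule theI')
  have "of_int m / of_nat n = (of_int m' / of_int n' :: rat)"
    using quotient_of_div[OF q] .
  then have "of_int (m * n') = (of_int (m' * int n) :: rat)"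
    using assms n' by (simp add: field_simps)
  then have eq: "m' * int n = m * int (nat n')" using n' by (simp only: of_int_eq_iff) simp
  have "(?y ^ n) ^ nat n' = (x powi m) ^ nat n'"
  proof -
    have "(?y ^ n) ^ nat n' = (?y ^ nat n') ^ n"
      by (simp only: power_mult[symmetric] mult.commute)
    also have "\<dots> = (x powi m) ^ nat n'" by (simp only: y powi_power eq)
    finally show ?thesis .
  qed
  moreover have "0 < nat n'" using n' by simp
  ultimately have "?y ^ n = x powi m" using power_eq_imp_eq by blast
  then show ?thesis using power_eq_imp_eq[OF assms, of ?y y] by auto
qed

definition trop_poly ::
    "nat \<Rightarrow> nat \<Rightarrow> (nat \<Rightarrow> 'a) \<Rightarrow> (nat \<Rightarrow> nat \<Rightarrow> rat)
      \<Rightarrow> (nat \<Rightarrow> 'a) \<Rightarrow> 'a::linordered_radicable_idempotent_semifield"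
  where "trop_poly m n a p x = (\<Sum>i=1..m. a i * (\<Prod>j=1..n. x j rpow p i j))"

definition feasible ::
    "nat \<Rightarrow> (nat \<Rightarrow> 'a) \<Rightarrow> (nat \<Rightarrow> 'a)
      \<Rightarrow> (nat \<Rightarrow> 'a::linordered_radicable_idempotent_semifield) \<Rightarrow> bool"
  where "feasible n g h x \<longleftrightarrow> (\<forall>j\<in>{1..n}. x j \<noteq> 0 \<and> g j \<le> x j \<and> x j \<le> h j)"

text \<open>
  The expression \<open>(h\<^sup>-\<^sup>t \<oplus> g\<^sup>-\<^sup>t)\<^sup>-\<^sup>1\<close>. If \<open>g = 0\<close> and \<open>t > 0\<close>, then \<open>g\<^sup>-\<^sup>t\<close>
  is an infinite summand, and the value is \<open>0\<close>. See \<open>inv_pow_sum_cases\<close>.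
\<close>

definition inv_pow_sum :: "'a \<Rightarrow> 'a \<Rightarrow> rat \<Rightarrow> 'a::linordered_radicable_idempotent_semifield"
  where "inv_pow_sum g h t =
    (if g = 0 \<and> 0 < t then 0 else inverse (h rpow (- t) + g rpow (- t)))"

lemma inv_pow_sum_cases:
  fixes g h :: "'a::linordered_radicable_idempotent_semifield"
  assumes h: "h \<noteq> 0" and gh: "g \<le> h"
  shows "inv_pow_sum g h t = (if t < 0 then h rpow t else if t = 0 then 1 else g rpow t)"
proof -
  have nz: "x * y \<noteq> 0" if "x \<noteq> 0" "y \<noteq> 0" for x y :: 'a
  proof
    assume "x * y = 0"
    then have "inverse x * (x * y) = 0" by simp
    moreover have "inverse x * (x * y) = (x * inverse x) * y" by (simp only: mult.commute mult.assoc mult.left_commute)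
    ultimately show False using that mult_inverse[OF that(1)] by simp
  qed
  have inv_unique: "inverse x = y" if "x * y = 1" for x y :: 'a
  proof -
    have "x \<noteq> 0" using that by auto
    have "inverse x = inverse x * (x * y)" using that by simp
    also have "\<dots> = (x * inverse x) * y" by (simp only: mult.commute mult.assoc mult.left_commute)
    finally show ?thesis using mult_inverse[OF \<open>x \<noteq> 0\<close>] by simp
  qed
  have mult_mono': "z * x \<le> z * y" if "x \<le> y" for x y z :: 'a
    using that by (simp add: le_iff_add_eq flip: distrib_left)
  have pow_mono: "x ^ n \<le> y ^ n" if "x \<le> y" for x y :: 'a and n
  proof (induction n)
    case (Suc n)
    have "x * x ^ n \<le> x * y ^ n" using Suc by (rule mult_mono')
    also have "\<dots> \<le> y * y ^ n" using mult_mono'[OF that, of "y ^ n"] by (simp add: mult.commute)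
    finally show ?case by simp
  qed simp
  have rep: "\<exists>m n. 0 < n \<and> t = of_int m / of_nat n" for t :: rat
  proof -
    obtain m n where q: "quotient_of t = (m, n)" by (cases "quotient_of t")
    then have "0 < nat n" "t = of_int m / of_nat (nat n)"
      using quotient_of_denom_pos[OF q] quotient_of_div[OF q] by auto
    then show ?thesis by blast
  qed
  have rp0: "x rpow 0 = 1" for x :: 'a
    using rpow_unique[of 1 x 0 1] by simp
  have rmono: "x rpow t \<le> y rpow t" if "x \<le> y" "0 < t" for x y :: 'a and t
  proof (rule ccontr)
    assume "\<not> ?thesis"
    then have less: "y rpow t < x rpow t" by simp
    obtain m n where t: "0 < n" "t = of_int m / of_nat n" using rep by blast
    then have m: "0 < m" using \<open>0 < t\<close> by (simp add: zero_less_divide_iff)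
    have "(y rpow t) ^ n = y powi m" "(x rpow t) ^ n = x powi m"
      using rpow_unique[OF t(1), of y m "y rpow t"] rpow_unique[OF t(1), of x m "x rpow t"] t(2)
      by simp_all
    moreover have "x powi m \<le> y powi m"
      using m pow_mono[OF that(1)] by (simp add: power_int_def)
    ultimately have "(y rpow t) ^ n = (x rpow t) ^ n"
      using pow_mono[of "y rpow t" "x rpow t" n] less by simp
    then have "y rpow t = x rpow t" by (rule power_eq_imp_eq[OF t(1)])
    then show False using less by simp
  qed
  have rinv: "x rpow (- t) = inverse (x rpow t)" if "x \<noteq> 0" for x :: 'a and t
  proof -
    obtain m n where t: "0 < n" "t = of_int m / of_nat n" using rep by blast
    have 1: "(x rpow t) ^ n = x powi m" using rpow_unique[OF t(1), of x m "x rpow t"] t(2) by simp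
    have "- t = of_int (- m) / of_nat n" using t(2) by simp
    then have 2: "(x rpow (- t)) ^ n = x powi (- m)"
      using rpow_unique[OF t(1), of x "- m" "x rpow (- t)"] by simp
    have "x powi m * x powi (- m) = 1"
    proof -
      have "x ^ k * inverse x ^ k = 1" for k
        using mult_inverse[OF that] by (simp flip: power_mult_distrib)
      moreover from this have "inverse x ^ k * x ^ k = 1" for k by (simp only: mult.commute)
      ultimately show ?thesis by (cases m "0::int" rule: linorder_cases) (simp_all add: power_int_def)
    qed
    then have "(x rpow t * x rpow (- t)) ^ n = 1 ^ n" by (simp add: power_mult_distrib 1 2)
    then have "x rpow t * x rpow (- t) = 1" by (rule power_eq_imp_eq[OF t(1)])
    then show ?thesis by (rule inv_unique[symmetric])
  qed
  have rp_nz: "x rpow t \<noteq> 0" if "x \<noteq> 0" for x :: 'a and t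
  proof -
    obtain m n where t: "0 < n" "t = of_int m / of_nat n" using rep by blast
    have 1: "(x rpow t) ^ n = x powi m" using rpow_unique[OF t(1), of x m "x rpow t"] t(2) by simp
    have "inverse x \<noteq> 0" using mult_inverse[OF that] by auto
    moreover have "z ^ k \<noteq> 0" if "z \<noteq> 0" for z :: 'a and k
      by (induction k) (use that nz in auto)
    ultimately have "x powi m \<noteq> 0" using that by (simp add: power_int_def)
    then show ?thesis using 1 t(1) by (auto simp: zero_power)
  qed
  have r0: "(0 :: 'a) rpow t = 0" if "0 < t" for t
  proof -
    obtain m n where t: "0 < n" "t = of_int m / of_nat n" using rep by blast
    then have "0 < m" using that by (simp add: zero_less_divide_iff)
    then show ?thesis using t rpow_unique[OF t(1), of 0 m 0] by (simp add: power_int_def zero_power)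
  qed
  have inv_inv: "inverse (inverse x) = x" if "x \<noteq> 0" for x :: 'a
    using inv_unique[of "inverse x" x] mult_inverse[OF that] by (simp add: mult.commute)
  consider "t < 0" | "t = 0" | "0 < t" "g = 0" | "0 < t" "g \<noteq> 0" by linarith
  then show ?thesis
  proof cases
    case 1
    then have "g rpow (- t) \<le> h rpow (- t)" using rmono[OF gh] by simp
    then have "h rpow (- t) + g rpow (- t) = h rpow (- t)"
      by (simp add: le_iff_add_eq add.commute)
    then show ?thesis using 1 rinv[OF h] inv_inv[OF rp_nz[OF h]] by (simp add: inv_pow_sum_def)
  next
    case 2
    then show ?thesis using inv_unique[of 1 1] by (simp add: inv_pow_sum_def rp0 add_idem)
  next
    case 3
    then show ?thesis using r0 by (simp add: inv_pow_sum_def)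
  next
    case 4
    let ?u = "g rpow t" and ?v = "h rpow t"
    have nzs: "?u \<noteq> 0" "?v \<noteq> 0" using rp_nz h 4 by auto
    have "inverse ?v * (?u * inverse ?u) = inverse ?u * inverse ?v * ?u"
      by (simp only: mult.commute mult.assoc mult.left_commute)
    also have "\<dots> \<le> inverse ?u * inverse ?v * ?v"
      using mult_mono'[OF rmono[OF gh 4(1)]] .
    also have "\<dots> = inverse ?u * (?v * inverse ?v)"
      by (simp only: mult.commute mult.assoc mult.left_commute)
    finally have "inverse ?v \<le> inverse ?u"
      using mult_inverse[OF nzs(1)] mult_inverse[OF nzs(2)] by simp
    then have "h rpow (- t) + g rpow (- t) = inverse ?u"
      using rinv[OF h] rinv[OF 4(2)] by (simp add: le_iff_add_eq)
    then show ?thesis using 4 inv_inv[OF nzs(1)] by (simp add: inv_pow_sum_def)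
  qed
qed

text \<open>
  Eliminating \<open>x\<^sub>N\<close> from a tropical polynomial program leads to a program whose objective vanishes
  identically exactly when every exponent of \<open>x\<^sub>N\<close> is positive and \<open>x\<^sub>N\<close> has the lower bound \<open>0\<close>.
  Its minimum \<open>\<mu>\<close> is then \<open>0\<close>, so that negative powers of \<open>\<mu>\<close> are infinite, and the upper
  bound on \<open>x\<^sub>N\<close>, an inverse of a sum of such powers, is read as \<open>0\<close>. In that situation the
  original program has no minimizer, since \<open>x\<^sub>N\<close> can always be decreased; the only exception
  is the two-element semifield.
\<close>

end

theory Submission
  imports Defs
begin

text \<open>
  Fix all variables but \<open>x\<^sub>N\<close> and a nonzero level \<open>z\<close>. A constraint \<open>u x\<^sub>N\<^sup>p \<le> z\<close> is a lower bound
  on \<open>x\<^sub>N\<close> if \<open>p < 0\<close>, an upper bound if \<open>p > 0\<close>, and does not involve \<open>x\<^sub>N\<close> if \<open>p = 0\<close>. By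
  linearity of the order, a suitable \<open>x\<^sub>N\<close> between \<open>g\<^sub>N\<close> and \<open>h\<^sub>N\<close> exists iff every lower bound is
  below every upper bound, and these comparisons say exactly that the reduced objective is at
  most \<open>z\<close>. Hence both problems have the same nonzero minimum \<open>\<mu>\<close>, and for \<open>z = \<mu>\<close> the bounds on
  \<open>x\<^sub>N\<close> form the double inequality. If the reduced objective vanishes, all exponents of \<open>x\<^sub>N\<close> are
  positive and \<open>g\<^sub>N = 0\<close>; then shrinking \<open>x\<^sub>N\<close> by a factor below \<open>1\<close> strictly decreases the
  original objective, which has no minimizer.
\<close>

\<comment> \<open>Order and arithmetic of idempotent semifields\<close>
subclass (in idempotent_semifield) semiring_1_no_zero_divisors
proof
  fix x y :: 'a
  assume nz: "x \<noteq> 0" "y \<noteq> 0"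
  show "x * y \<noteq> 0"
  proof
    assume "x * y = 0"
    then have "inverse x * (x * y) = 0" by simp
    then have "(x * inverse x) * y = 0" by (simp only: ac_simps)
    then show False using nz mult_inverse by simp
  qed
qed

subclass (in idempotent_semifield) ordered_comm_semiring
proof
  fix x y z :: 'a
  assume "x \<le> y"
  then have xy: "x + y = y" by (simp add: le_iff_add_eq)
  have "(z + x) + (z + y) = (z + z) + (x + y)" by (simp only: ac_simps)
  then show "z + x \<le> z + y" by (simp add: le_iff_add_eq add_idem xy)
  have "z * x + z * y = z * y" using xy by (simp flip: distrib_left)
  then show "z * x \<le> z * y" by (simp add: le_iff_add_eq)
qed

\<comment> \<open>If \<open>x \<le> y\<close>, then \<open>y = x + y\<close> is the required
  decomposition; conversely, idempotence absorbs the repeated \<open>x\<close>. The instance makes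
  \<open>0\<close> the least element, so vanishing terms satisfy every upper bound.\<close>
subclass (in idempotent_semifield) canonically_ordered_monoid_add
proof
  fix x y :: 'a
  have "x + (x + z) = x + z" for z by (simp add: add_idem flip: add.assoc)
  then show "x \<le> y \<longleftrightarrow> (\<exists>z. y = x + z)" by (metis le_iff_add_eq)
qed

lemma add_le_iff:
  fixes x y z :: "'a::idempotent_semifield"
  shows "x + y \<le> z \<longleftrightarrow> x \<le> z \<and> y \<le> z"
proof
  assume "x + y \<le> z"
  moreover have "x \<le> x + y" "y \<le> x + y"
    by (simp_all add: le_iff_add_eq add_idem add.left_commute flip: add.assoc)
  ultimately show "x \<le> z \<and> y \<le> z" by (meson order_trans)
next
  assume "x \<le> z \<and> y \<le> z"
  then show "x + y \<le> z" using add_mono[of x z y z] by (simp add: add_idem)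
qed

lemma sum_le_iff:
  fixes f :: "'b \<Rightarrow> 'a::idempotent_semifield"
  shows "finite A \<Longrightarrow> sum f A \<le> z \<longleftrightarrow> (\<forall>i\<in>A. f i \<le> z)"
  by (induction A rule: finite_induct) (auto simp: add_le_iff)

text \<open>In a linear order addition is the maximum, so a nonempty finite sum is bounded by its
  largest term, and every term is bounded by the sum.\<close>

lemma sum_attained:
  fixes f :: "'b \<Rightarrow> 'a::linordered_idempotent_semifield"
  assumes "finite A" "A \<noteq> {}"
  obtains i where "i \<in> A" "sum f A = f i"
proof -
  have "\<exists>i\<in>A. sum f A \<le> f i"
  proof (rule ccontr)
    assume "\<not> ?thesis"
    moreover obtain i where "i \<in> A" "\<forall>k\<in>A. f k \<le> f i"
      using finite_has_maximal[of "f ` A"] assms by (metis (no_types, lifting) finite_imageI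
          image_is_empty imageE imageI linear)
    ultimately show False using sum_le_iff[OF assms(1)] by blast
  qed
  moreover have "f i \<le> sum f A" if "i \<in> A" for i
    using sum_le_iff[OF assms(1), of f "sum f A"] that by simp
  ultimately show ?thesis using that by (metis order_antisym)
qed

lemma semifield_inverse_nonzero [simp]:
  fixes x :: "'a::idempotent_semifield"
  assumes "x \<noteq> 0"
  shows "inverse x \<noteq> 0"
  using mult_inverse[OF assms] by auto

lemma semifield_mult_left_le_iff:
  fixes x y z :: "'a::idempotent_semifield"
  assumes "z \<noteq> 0"
  shows "z * x \<le> z * y \<longleftrightarrow> x \<le> y"
proof
  assume "z * x \<le> z * y"
  then have "inverse z * (z * x) \<le> inverse z * (z * y)" by (rule mult_left_mono) simp
  moreover have "inverse z * (z * w) = w" for w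
    using mult_inverse[OF assms] by (metis mult.assoc mult.commute mult_1)
  ultimately show "x \<le> y" by simp
qed (simp add: mult_left_mono)

lemma semifield_le_mult_inverse_iff:
  fixes x y z :: "'a::idempotent_semifield"
  assumes "z \<noteq> 0"
  shows "x \<le> y * inverse z \<longleftrightarrow> z * x \<le> y"
proof -
  have "z * (y * inverse z) = y"
    using mult_inverse[OF assms] by (simp add: mult.left_commute)
  then show ?thesis using semifield_mult_left_le_iff[OF assms, of x "y * inverse z"] by simp
qed

lemma semifield_inverse_unique:
  fixes x y :: "'a::idempotent_semifield"
  assumes "x * y = 1"
  shows "inverse x = y"
proof -
  have nz: "x \<noteq> 0" using assms by auto
  have "inverse x = inverse x * (x * y)" using assms by simp
  also have "\<dots> = (x * inverse x) * y" by (simp only: ac_simps)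
  finally show ?thesis using mult_inverse[OF nz] by simp
qed

lemma semifield_inverse_inverse [simp]:
  fixes x :: "'a::idempotent_semifield"
  assumes "x \<noteq> 0"
  shows "inverse (inverse x) = x"
  using mult_inverse[OF assms] by (intro semifield_inverse_unique) (simp add: mult.commute)

lemma semifield_le_inverse_iff:
  fixes x y :: "'a::idempotent_semifield"
  assumes "x \<noteq> 0" "y \<noteq> 0"
  shows "x \<le> inverse y \<longleftrightarrow> y \<le> inverse x"
  using semifield_le_mult_inverse_iff[OF assms(1), of y 1]
    semifield_le_mult_inverse_iff[OF assms(2), of x 1]
  by (simp add: mult.commute)

lemma semifield_inverse_le_iff:
  fixes x y :: "'a::idempotent_semifield"
  assumes "x \<noteq> 0" "y \<noteq> 0"
  shows "inverse x \<le> inverse y \<longleftrightarrow> y \<le> x"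
  using semifield_le_inverse_iff[of "inverse x" y] assms by simp

section \<open>Powers with natural, integer and rational exponents\<close>

lemma semifield_power_mono:
  fixes x y :: "'a::idempotent_semifield"
  assumes "x \<le> y"
  shows "x ^ n \<le> y ^ n"
  using assms by (induction n) (auto intro: mult_mono)

text \<open>Multiplying by \<open>x ^ l\<close> clears the inverses: if \<open>k < l\<close>, the
  factor \<open>x ^ (l - k)\<close> of \<open>x ^ l\<close> cancels the negative power and leaves
  \<open>x ^ k\<close>.\<close>

lemma power_mult_powi:
  fixes x :: "'a::idempotent_semifield"
  assumes "x \<noteq> 0"
  shows "x powi (int k - int l) * x ^ l = x ^ k"
proof (cases "l \<le> k")
  case True
  then show ?thesis by (simp add: power_int_def nat_diff_distrib flip: power_add)
next
  case False
  then have "x ^ l = x ^ (l - k) * x ^ k" by (simp flip: power_add)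
  moreover have "inverse x ^ (l - k) * x ^ (l - k) = 1"
    using mult_inverse[OF assms] by (simp add: mult.commute flip: power_mult_distrib)
  ultimately show ?thesis using False
    by (simp add: power_int_def nat_diff_distrib flip: mult.assoc)
qed

lemma semifield_mult_right_cancel:
  fixes x y z :: "'a::idempotent_semifield"
  assumes "z \<noteq> 0"
  shows "x * z = y * z \<longleftrightarrow> x = y"
  using mult_inverse[OF assms] by (metis mult.assoc mult_1_right)

text \<open>With the numerator split as \<open>k - l\<close>, the power is characterised by an
  equation free of inverses. The laws of exponents then reduce to computations in a commutative
  semiring and uniqueness of roots.\<close>

lemma rpow_eq_iff:
  fixes x y :: "'a::linordered_radicable_idempotent_semifield"
  assumes "x \<noteq> 0" "0 < n" "t = (of_nat k - of_nat l) / of_nat n"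
  shows "x rpow t = y \<longleftrightarrow> y ^ n * x ^ l = x ^ k"
proof -
  have t: "t = of_int (int k - int l) / of_nat n" using assms(3) by simp
  have "x rpow t = y \<longleftrightarrow> y ^ n = x powi (int k - int l)"
    unfolding t using assms(2) by (rule rpow_unique)
  also have "\<dots> \<longleftrightarrow> y ^ n * x ^ l = x powi (int k - int l) * x ^ l"
    using assms(1) by (simp add: semifield_mult_right_cancel)
  finally show ?thesis by (simp add: power_mult_powi[OF assms(1)])
qed

lemma rat_nat_representation:
  obtains k l n :: nat where "0 < n" "t = (of_nat k - of_nat l) / (of_nat n :: rat)"
proof -
  obtain m n where q: "quotient_of t = (m, n)" by (cases "quotient_of t")
  have "0 < nat n" "t = of_int m / of_nat (nat n)"
    using quotient_of_denom_pos[OF q] quotient_of_div[OF q] by auto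
  moreover have "m = int (nat m) - int (nat (- m))" by simp
  then have "of_int m = (of_nat (nat m) - of_nat (nat (- m)) :: rat)"
    by (metis of_int_diff of_int_of_nat_eq)
  ultimately show ?thesis using that by metis
qed

text \<open>A positive numerator avoids inverses altogether, so this form also serves the base
  \<open>0\<close>, which \<open>rpow_eq_iff\<close> excludes.\<close>

lemma pos_rat_nat_representation:
  assumes "0 < t"
  obtains k n :: nat where "0 < n" "0 < k" "t = of_int (int k) / (of_nat n :: rat)"
proof -
  obtain m n where q: "quotient_of t = (m, n)" by (cases "quotient_of t")
  have n: "0 < nat n" and t: "t = of_int m / of_nat (nat n)"
    using quotient_of_denom_pos[OF q] quotient_of_div[OF q] by auto
  then have "0 < m" using assms by (simp add: zero_less_divide_iff)
  then show ?thesis using that[OF n, of "nat m"] t by simp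
qed

lemma rpow_0 [simp]:
  fixes x :: "'a::linordered_radicable_idempotent_semifield"
  shows "x rpow 0 = 1"
  using rpow_unique[of 1 x 0 1] by simp

lemma rpow_1 [simp]:
  fixes x :: "'a::linordered_radicable_idempotent_semifield"
  shows "x rpow 1 = x"
  using rpow_unique[of 1 x 1 x] by (simp add: power_int_def)

lemma zero_rpow:
  assumes "0 < t"
  shows "(0 :: 'a::linordered_radicable_idempotent_semifield) rpow t = 0"
proof -
  obtain k n :: nat where "0 < n" "0 < k" "t = of_int (int k) / of_nat n"
    using pos_rat_nat_representation[OF assms] .
  then show ?thesis using rpow_unique[of n 0 "int k" 0] by (simp add: zero_power)
qed

lemma rpow_nonzero [simp]:
  fixes x :: "'a::linordered_radicable_idempotent_semifield"
  assumes "x \<noteq> 0"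
  shows "x rpow t \<noteq> 0"
proof -
  obtain k l n :: nat where "0 < n" "t = (of_nat k - of_nat l) / of_nat n"
    using rat_nat_representation .
  then have "(x rpow t) ^ n * x ^ l = x ^ k" using rpow_eq_iff[OF assms] by blast
  then show ?thesis using assms \<open>0 < n\<close> by (auto simp: zero_power)
qed

text \<open>The defining equations of both powers, each raised to the denominator of the other and
  then multiplied, give the defining equation for the sum of the exponents.\<close>

lemma rpow_add:
  fixes x :: "'a::linordered_radicable_idempotent_semifield"
  assumes x: "x \<noteq> 0"
  shows "x rpow (s + t) = x rpow s * x rpow t"
proof -
  obtain k l n :: nat where s: "0 < n" "s = (of_nat k - of_nat l) / of_nat n"
    using rat_nat_representation .
  obtain k' l' n' :: nat where t: "0 < n'" "t = (of_nat k' - of_nat l') / of_nat n'"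
    using rat_nat_representation .
  have "(x rpow s) ^ n * x ^ l = x ^ k" "(x rpow t) ^ n' * x ^ l' = x ^ k'"
    using rpow_eq_iff[OF x] s t by blast+
  then have "((x rpow s) ^ n * x ^ l) ^ n' * ((x rpow t) ^ n' * x ^ l') ^ n
      = (x ^ k) ^ n' * (x ^ k') ^ n" by simp
  then have "(x rpow s * x rpow t) ^ (n * n') * x ^ (l * n' + l' * n) = x ^ (k * n' + k' * n)"
    by (simp add: power_mult_distrib power_add ac_simps flip: power_mult)
  moreover have "s + t = (of_nat (k * n' + k' * n) - of_nat (l * n' + l' * n)) / of_nat (n * n')"
    unfolding s(2) t(2) using s(1) t(1) by (simp add: add_frac_eq algebra_simps)
  moreover have "0 < n * n'" using s(1) t(1) by simp
  ultimately show ?thesis using rpow_eq_iff[OF x] by blast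
qed

lemma rpow_mult_distrib:
  fixes x y :: "'a::linordered_radicable_idempotent_semifield"
  assumes "x \<noteq> 0" "y \<noteq> 0"
  shows "(x * y) rpow t = x rpow t * y rpow t"
proof -
  obtain k l n :: nat where t: "0 < n" "t = (of_nat k - of_nat l) / of_nat n"
    using rat_nat_representation .
  have "(x rpow t) ^ n * x ^ l = x ^ k" "(y rpow t) ^ n * y ^ l = y ^ k"
    using rpow_eq_iff assms t by blast+
  then have "((x rpow t) ^ n * x ^ l) * ((y rpow t) ^ n * y ^ l) = x ^ k * y ^ k" by simp
  then have "(x rpow t * y rpow t) ^ n * (x * y) ^ l = (x * y) ^ k"
    by (simp add: power_mult_distrib ac_simps)
  then show ?thesis using rpow_eq_iff[of "x * y"] assms t by simp
qed

text \<open>Over the denominator \<open>n * n'\<close>, the equation for the inner power first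
  replaces \<open>x ^ k\<close>, then the equation for the outer power applies, and the inner one is
  used again in the opposite direction.\<close>

lemma rpow_rpow:
  fixes x :: "'a::linordered_radicable_idempotent_semifield"
  assumes x: "x \<noteq> 0"
  shows "(x rpow s) rpow t = x rpow (s * t)"
proof -
  obtain k l n :: nat where s: "0 < n" "s = (of_nat k - of_nat l) / of_nat n"
    using rat_nat_representation .
  obtain k' l' n' :: nat where t: "0 < n'" "t = (of_nat k' - of_nat l') / of_nat n'"
    using rat_nat_representation .
  let ?y = "x rpow s" and ?z = "(x rpow s) rpow t"
  have y: "?y ^ n * x ^ l = x ^ k"
    by (rule rpow_eq_iff[OF x s, THEN iffD1, OF refl])
  have z: "?z ^ n' * ?y ^ l' = ?y ^ k'"
    by (rule rpow_eq_iff[OF rpow_nonzero[OF x] t, THEN iffD1, OF refl])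
  have "?z ^ (n * n') * x ^ (k * l' + l * k') = ?z ^ (n * n') * (?y ^ n * x ^ l) ^ l' * x ^ (l * k')"
    by (simp only: y power_add power_mult mult.assoc)
  also have "\<dots> = (?z ^ n' * ?y ^ l') ^ n * x ^ (l * l') * x ^ (l * k')"
    by (simp only: power_mult_distrib ac_simps flip: power_mult)
  also have "\<dots> = (?y ^ n * x ^ l) ^ k' * x ^ (l * l')"
    unfolding z by (simp only: power_mult_distrib ac_simps flip: power_mult)
  also have "\<dots> = x ^ (k * k' + l * l')"
    by (simp only: y power_add power_mult)
  finally have eq: "?z ^ (n * n') * x ^ (k * l' + l * k') = x ^ (k * k' + l * l')" .
  have st: "s * t = (of_nat (k * k' + l * l') - of_nat (k * l' + l * k')) / of_nat (n * n')"
    unfolding s(2) t(2) by (simp add: algebra_simps)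
  have "0 < n * n'" using s(1) t(1) by simp
  from rpow_eq_iff[OF x this st, THEN iffD2, OF eq] show ?thesis ..
qed

lemma rpow_minus:
  fixes x :: "'a::linordered_radicable_idempotent_semifield"
  assumes "x \<noteq> 0"
  shows "x rpow (- t) = inverse (x rpow t)"
  using rpow_add[OF assms, of t "- t"] by (intro semifield_inverse_unique[symmetric]) simp

lemma inverse_rpow:
  fixes x :: "'a::linordered_radicable_idempotent_semifield"
  assumes "x \<noteq> 0"
  shows "inverse x rpow t = x rpow (- t)"
  using rpow_minus[OF assms, of 1] rpow_rpow[OF assms, of "- 1" t] by simp

lemma one_rpow [simp]: "(1 :: 'a::linordered_radicable_idempotent_semifield) rpow t = 1"
  using rpow_rpow[of "1::'a" 0 t] by simp

lemma semifield_prod_nonzero: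
  fixes f :: "'b \<Rightarrow> 'a::idempotent_semifield"
  assumes "\<And>j. j \<in> A \<Longrightarrow> f j \<noteq> 0"
  shows "prod f A \<noteq> 0"
  using assms by (induction A rule: infinite_finite_induct) simp_all

lemma prod_rpow:
  fixes f :: "'b \<Rightarrow> 'a::linordered_radicable_idempotent_semifield"
  assumes "\<And>j. j \<in> A \<Longrightarrow> f j \<noteq> 0"
  shows "prod f A rpow t = (\<Prod>j\<in>A. f j rpow t)"
  using assms
proof (induction A rule: infinite_finite_induct)
  case (insert j A)
  then have "prod f A \<noteq> 0" "f j \<noteq> 0" by (auto intro!: semifield_prod_nonzero)
  then show ?case using insert by (simp add: rpow_mult_distrib)
qed simp_all

text \<open>If the powers were strictly in the opposite order, their \<open>n\<close>-th powers
  would be comparable both ways, hence equal, and uniqueness of roots would identify them. Zero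
  bases are included.\<close>

lemma rpow_mono:
  fixes x y :: "'a::linordered_radicable_idempotent_semifield"
  assumes "x \<le> y" "0 < t"
  shows "x rpow t \<le> y rpow t"
proof (rule ccontr)
  assume "\<not> ?thesis"
  then have less: "y rpow t < x rpow t" by simp
  obtain k n :: nat where t: "0 < n" "t = of_int (int k) / of_nat n"
    using pos_rat_nat_representation[OF assms(2)] .
  have eq: "(z rpow t) ^ n = z ^ k" for z :: 'a
    using rpow_unique[OF t(1), of z "int k" "z rpow t"] t(2) by simp
  have "(x rpow t) ^ n \<le> (y rpow t) ^ n"
    unfolding eq using assms(1) by (rule semifield_power_mono)
  moreover have "(y rpow t) ^ n \<le> (x rpow t) ^ n"
    using less by (intro semifield_power_mono) simp
  ultimately have "y rpow t = x rpow t" using power_eq_imp_eq[OF t(1)] by (metis order_antisym)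
  then show False using less by simp
qed

lemma rpow_le_iff:
  fixes x y :: "'a::linordered_radicable_idempotent_semifield"
  assumes "x \<noteq> 0" "y \<noteq> 0" "0 < t"
  shows "x rpow t \<le> y rpow t \<longleftrightarrow> x \<le> y"
proof
  assume "x rpow t \<le> y rpow t"
  then have "(x rpow t) rpow (1 / t) \<le> (y rpow t) rpow (1 / t)"
    by (rule rpow_mono) (use assms(3) in simp)
  then show "x \<le> y" using assms by (simp add: rpow_rpow)
qed (rule rpow_mono[OF _ assms(3)])

section \<open>Monomial inequalities in one variable\<close>

lemma mult_rpow_le_iff_pos:
  fixes u x z :: "'a::linordered_radicable_idempotent_semifield"
  assumes "u \<noteq> 0" "x \<noteq> 0" "z \<noteq> 0" "0 < t"
  shows "u * x rpow t \<le> z \<longleftrightarrow> x \<le> (z * inverse u) rpow (1 / t)"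
proof -
  have "u * x rpow t \<le> z \<longleftrightarrow> x rpow t \<le> z * inverse u"
    using assms by (simp add: semifield_le_mult_inverse_iff)
  also have "\<dots> \<longleftrightarrow> (x rpow t) rpow (1 / t) \<le> (z * inverse u) rpow (1 / t)"
    using assms by (simp add: rpow_le_iff)
  finally show ?thesis using assms by (simp add: rpow_rpow)
qed

text \<open>Passing to \<open>inverse x\<close> makes the exponent positive; inverting the resulting
  upper bound gives a lower bound on \<open>x\<close>.\<close>

lemma mult_rpow_le_iff_neg:
  fixes u x z :: "'a::linordered_radicable_idempotent_semifield"
  assumes "u \<noteq> 0" "x \<noteq> 0" "z \<noteq> 0" "t < 0"
  shows "u * x rpow t \<le> z \<longleftrightarrow> (z * inverse u) rpow (1 / t) \<le> x"
proof -
  have "u * x rpow t \<le> z \<longleftrightarrow> u * inverse x rpow (- t) \<le> z"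
    using assms by (simp add: inverse_rpow)
  also have "\<dots> \<longleftrightarrow> inverse x \<le> (z * inverse u) rpow (- (1 / t))"
    using assms by (simp add: mult_rpow_le_iff_pos)
  finally show ?thesis using assms by (simp add: rpow_minus semifield_inverse_le_iff)
qed

lemma mult_rpow_le_iff:
  fixes u x z :: "'a::linordered_radicable_idempotent_semifield"
  assumes "u \<noteq> 0" "x \<noteq> 0" "z \<noteq> 0"
  shows "u * x rpow t \<le> z \<longleftrightarrow>
    (if t < 0 then (z * inverse u) rpow (1 / t) \<le> x
     else if t = 0 then u \<le> z else x \<le> (z * inverse u) rpow (1 / t))"
  using assms by (simp add: mult_rpow_le_iff_neg mult_rpow_le_iff_pos)

text \<open>
  The left-hand side is the weighted geometric mean in which the powers of the eliminated
  variable cancel: the weights \<open>- t / (s - t)\<close> and \<open>s / (s - t)\<close> are positive and add up to \<open>1\<close>.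
\<close>

lemma weighted_mean_le_iff:
  fixes u v z :: "'a::linordered_radicable_idempotent_semifield"
  assumes nz: "u \<noteq> 0" "v \<noteq> 0" "z \<noteq> 0" and st: "s < 0" "0 < t"
  shows "u rpow (- (t / (s - t))) * v rpow (s / (s - t)) \<le> z
    \<longleftrightarrow> (z * inverse u) rpow (1 / s) \<le> (z * inverse v) rpow (1 / t)"
proof -
  define \<alpha> where "\<alpha> = - (t / (s - t))"
  define \<beta> where "\<beta> = s / (s - t)"
  have \<beta>: "0 < \<beta>" "\<alpha> + \<beta> = 1" "t / s * \<beta> = - \<alpha>"
    using st by (simp_all add: \<alpha>_def \<beta>_def zero_less_divide_iff flip: diff_divide_distrib)
  have "(z * inverse u) rpow (1 / s) \<le> (z * inverse v) rpow (1 / t)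
      \<longleftrightarrow> v * ((z * inverse u) rpow (1 / s)) rpow t \<le> z"
    using nz st by (simp add: mult_rpow_le_iff_pos)
  \<comment> \<open>The positive power \<beta> preserves the inequality, and
    \<open>t / s * \<beta> = - \<alpha>\<close> turns the exponent of \<open>u\<close> into
    \<alpha>.\<close>
  also have "\<dots> \<longleftrightarrow> (v * (z * inverse u) rpow (t / s)) rpow \<beta> \<le> z rpow \<beta>"
    using nz \<beta>(1) by (simp add: rpow_rpow rpow_le_iff)
  also have "(v * (z * inverse u) rpow (t / s)) rpow \<beta> = v rpow \<beta> * (z rpow (- \<alpha>) * u rpow \<alpha>)"
    using nz \<beta>(3) by (simp add: rpow_mult_distrib rpow_rpow inverse_rpow)
  \<comment> \<open>The factor \<open>z rpow \<alpha>\<close> removes \<open>z\<close> from the left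
    and, by \<open>\<alpha> + \<beta> = 1\<close>, leaves \<open>z\<close> itself on the
    right.\<close>
  also have "v rpow \<beta> * (z rpow (- \<alpha>) * u rpow \<alpha>) \<le> z rpow \<beta>
      \<longleftrightarrow> z rpow \<alpha> * (v rpow \<beta> * (z rpow (- \<alpha>) * u rpow \<alpha>)) \<le> z rpow \<alpha> * z rpow \<beta>"
    using nz by (simp add: semifield_mult_left_le_iff)
  also have "z rpow \<alpha> * (v rpow \<beta> * (z rpow (- \<alpha>) * u rpow \<alpha>))
      = (z rpow \<alpha> * z rpow (- \<alpha>)) * (u rpow \<alpha> * v rpow \<beta>)" by (simp only: ac_simps)
  also have "\<dots> = u rpow \<alpha> * v rpow \<beta>" using nz by (simp flip: rpow_add)
  also have "z rpow \<alpha> * z rpow \<beta> = z" using nz \<beta>(2) by (simp flip: rpow_add)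
  finally show ?thesis by (simp add: \<alpha>_def \<beta>_def)
qed

section \<open>Elimination of one variable and the indices of the reduced program\<close>

lemma inv_pow_sum_eq_0_iff:
  fixes g h :: "'a::linordered_radicable_idempotent_semifield"
  assumes "h \<noteq> 0" "g \<le> h"
  shows "inv_pow_sum g h t = 0 \<longleftrightarrow> 0 < t \<and> g = 0"
  using assms by (cases "g = 0") (simp_all add: inv_pow_sum_cases zero_rpow)

text \<open>The coefficient is the power \<open>x rpow t\<close> at the endpoint of the interval
  from \<open>g\<close> to \<open>h\<close> where it is smallest: \<open>h\<close> for
  \<open>t < 0\<close>, \<open>g\<close> for \<open>t > 0\<close>. So the condition says that the
  bound imposed on \<open>x\<close> by \<open>u * x rpow t \<le> z\<close> is compatible with that
  interval. For \<open>g = 0\<close> and \<open>t > 0\<close> both sides hold trivially.\<close>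

lemma inv_pow_sum_mult_le_iff:
  fixes g h u z :: "'a::linordered_radicable_idempotent_semifield"
  assumes "h \<noteq> 0" "g \<le> h" "u \<noteq> 0" "z \<noteq> 0"
  shows "inv_pow_sum g h t * u \<le> z \<longleftrightarrow>
    (if t < 0 then (z * inverse u) rpow (1 / t) \<le> h
     else if t = 0 then u \<le> z else g \<le> (z * inverse u) rpow (1 / t))"
proof (cases "0 < t \<and> g = 0")
  case True
  then show ?thesis using assms inv_pow_sum_eq_0_iff[of h g t] by simp
next
  case False
  then show ?thesis using assms
    by (auto simp: inv_pow_sum_cases mult.commute[of _ u] mult_rpow_le_iff)
qed

text \<open>
  A nonzero value \<open>z\<close> is attainable iff the interval cut out by \<open>g\<close>, \<open>h\<close> and the powers of
  \<open>z / u\<^sub>i\<close> with exponents \<open>1 / e\<^sub>i\<close> is nonempty; the right-hand side compares lower with upper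
  bounds pairwise.
\<close>

lemma eliminate_variable:
  fixes u :: "nat \<Rightarrow> 'a::linordered_radicable_idempotent_semifield"
  assumes fin: "finite I" and u: "\<And>i. i \<in> I \<Longrightarrow> u i \<noteq> 0"
    and gh: "h \<noteq> 0" "g \<le> h" and z: "z \<noteq> 0"
  shows "(\<exists>y. y \<noteq> 0 \<and> g \<le> y \<and> y \<le> h \<and> (\<forall>i\<in>I. u i * y rpow e i \<le> z)) \<longleftrightarrow>
    (\<forall>i\<in>I. \<forall>k\<in>I. e i < 0 \<and> 0 < e k \<longrightarrow>
      u i rpow (- (e k / (e i - e k))) * u k rpow (e i / (e i - e k)) \<le> z)
    \<and> (\<forall>i\<in>I. inv_pow_sum g h (e i) * u i \<le> z)"
    (is "(\<exists>y. ?P y) \<longleftrightarrow> ?Q")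
proof -
  \<comment> \<open>For \<open>e i \<noteq> 0\<close> this is the value of \<open>y\<close> at which
    the term \<open>u i * y rpow e i\<close> equals \<open>z\<close>.\<close>
  define v where "v i = (z * inverse (u i)) rpow (1 / e i)" for i
  have v_nz: "v i \<noteq> 0" if "i \<in> I" for i using u[OF that] z by (simp add: v_def)
  have Q: "?Q \<longleftrightarrow> (\<forall>i\<in>I. \<forall>k\<in>I. e i < 0 \<and> 0 < e k \<longrightarrow> v i \<le> v k)
      \<and> (\<forall>i\<in>I. if e i < 0 then v i \<le> h else if e i = 0 then u i \<le> z else g \<le> v i)"
    using u gh z by (auto simp: weighted_mean_le_iff inv_pow_sum_mult_le_iff v_def)
  have P: "u i * y rpow e i \<le> z \<longleftrightarrow>
      (if e i < 0 then v i \<le> y else if e i = 0 then u i \<le> z else y \<le> v i)"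
    if "i \<in> I" "y \<noteq> 0" for i y
    unfolding v_def using u[OF that(1)] that(2) z by (rule mult_rpow_le_iff)
  show ?thesis
  proof
    assume "\<exists>y. ?P y"
    then obtain y where y: "y \<noteq> 0" "g \<le> y" "y \<le> h" "\<forall>i\<in>I. u i * y rpow e i \<le> z" by blast
    then have "\<forall>i\<in>I. if e i < 0 then v i \<le> y else if e i = 0 then u i \<le> z else y \<le> v i"
      using P by blast
    then show ?Q unfolding Q using y(2,3) by (smt (verit) order_trans order_less_asym order_less_irrefl)
  next
    assume ?Q
    note bounds = this[unfolded Q]
    have pair: "v i \<le> v k" if "i \<in> I" "k \<in> I" "e i < 0" "0 < e k" for i k
      using bounds that by blast
    have single: "if e i < 0 then v i \<le> h else if e i = 0 then u i \<le> z else g \<le> v i"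
      if "i \<in> I" for i
      using bounds that by blast
    \<comment> \<open>The witness is the least upper bound in the list, \<open>m\<close>. It is
      nonzero because every member of \<open>U\<close> is, and \<open>h\<close> keeps
      \<open>U\<close> nonempty when no exponent is positive.\<close>
    define U where "U = insert h (v ` {k \<in> I. 0 < e k})"
    have "finite U" "U \<noteq> {}" using fin by (simp_all add: U_def)
    then obtain m where m: "m \<in> U" "\<And>w. w \<in> U \<Longrightarrow> m \<le> w" using Min_in Min_le by metis
    have m_cases: "m = h \<or> (\<exists>k\<in>I. 0 < e k \<and> m = v k)" using m(1) by (auto simp: U_def)
    have "m \<noteq> 0" using m_cases gh(1) v_nz by auto
    have "g \<le> m"
      using m_cases
    proof
      assume "\<exists>k\<in>I. 0 < e k \<and> m = v k"
      then obtain k where "k \<in> I" "0 < e k" "m = v k" by blast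
      then show ?thesis using single[of k] by simp
    qed (use gh(2) in simp)
    have lower: "v i \<le> m" if "i \<in> I" "e i < 0" for i
      using m_cases single[OF that(1)] that pair by auto
    have upper: "m \<le> h" "\<And>k. k \<in> I \<Longrightarrow> 0 < e k \<Longrightarrow> m \<le> v k"
      using m(2) by (simp_all add: U_def)
    have "u i * m rpow e i \<le> z" if i: "i \<in> I" for i
      unfolding P[OF i \<open>m \<noteq> 0\<close>] using single[OF i] lower[OF i] upper(2)[OF i]
      by (cases "e i" "0 :: rat" rule: linorder_cases) simp_all
    then have "?P m" using \<open>m \<noteq> 0\<close> \<open>g \<le> m\<close> upper(1) by blast
    then show "\<exists>y. ?P y" ..
  qed
qed

text \<open>The first \<open>M\<^sup>2\<close> indices list the ordered pairs row by row, the last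
  \<open>M\<close> the single indices. Since counting starts at \<open>1\<close>, quotient and
  remainder of \<open>l - 1\<close> by \<open>M\<close> are \<open>i - 1\<close> and
  \<open>k - 1\<close>.\<close>

lemma paired_indices:
  fixes M :: nat
  shows "(\<forall>l\<in>{1..M\<^sup>2 + M}. P l) \<longleftrightarrow>
    (\<forall>i\<in>{1..M}. \<forall>k\<in>{1..M}. P (M * (i - 1) + k)) \<and> (\<forall>i\<in>{1..M}. P (M\<^sup>2 + i))"
    (is "?L \<longleftrightarrow> ?R")
proof
  assume L: ?L
  have "M * (i - 1) + k \<in> {1..M\<^sup>2 + M}" if "i \<in> {1..M}" "k \<in> {1..M}" for i k
  proof -
    have "M * (i - 1) \<le> M * M" using that by (intro mult_le_mono) auto
    then have "M * (i - 1) + k \<le> M * M + M" using that by (intro add_mono) auto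
    then show ?thesis using that by (simp add: power2_eq_square)
  qed
  then show ?R using L by simp
next
  assume R: ?R
  show ?L
  proof
    fix l assume l: "l \<in> {1..M\<^sup>2 + M}"
    show "P l"
    proof (cases "l \<le> M\<^sup>2")
      case True
      let ?i = "Suc ((l - 1) div M)" and ?k = "Suc ((l - 1) mod M)"
      have M: "0 < M" using True l by (cases M) auto
      have "l - 1 < M * M" using True l by (auto simp: power2_eq_square)
      then have "(l - 1) div M < M" by (simp add: less_mult_imp_div_less)
      then have "?i \<in> {1..M}" "?k \<in> {1..M}" using M by (auto simp: Suc_le_eq)
      then have "P (M * (?i - 1) + ?k)" using R by blast
      moreover have "M * (?i - 1) + ?k = l" using l by simp
      ultimately show ?thesis by simp
    next
      case False
      then have "l - M\<^sup>2 \<in> {1..M}" "M\<^sup>2 + (l - M\<^sup>2) = l" using l by auto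
      then show ?thesis using R by metis
    qed
  qed
qed

section \<open>Equivalence of the two programs\<close>

lemma monomial_rpow:
  fixes a :: "'a::linordered_radicable_idempotent_semifield"
  assumes "a \<noteq> 0" "\<And>j. j \<in> A \<Longrightarrow> x j \<noteq> 0"
  shows "(a * (\<Prod>j\<in>A. x j rpow e j)) rpow t = a rpow t * (\<Prod>j\<in>A. x j rpow (e j * t))"
  using assms by (simp add: rpow_mult_distrib semifield_prod_nonzero prod_rpow rpow_rpow)

text \<open>One point \<open>x\<close> serves both programs, since the reduced one reads only the
  first \<open>N - 1\<close> coordinates; hence \<open>x N \<noteq> 0\<close> accompanies the double
  inequality. The assumption \<open>nondegenerate\<close> excludes the two-element semifield when
  all exponents of the last variable are positive and \<open>g N = 0\<close>: there the original
  minimum is \<open>1\<close> and the reduced one \<open>0\<close>.\<close>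

theorem lemma2:
  fixes p q r s :: "nat \<Rightarrow> nat \<Rightarrow> rat"
    and a b c d g h x :: "nat \<Rightarrow> 'a::linordered_radicable_idempotent_semifield"
    and \<mu> :: 'a
    and M N :: nat
  assumes "1 \<le> M" and "1 \<le> N"
    and a_nz: "\<And>i. i \<in> {1..M} \<Longrightarrow> a i \<noteq> 0"
    and h_nz: "\<And>j. j \<in> {1..N} \<Longrightarrow> h j \<noteq> 0"
    and g_le_h: "\<And>j. j \<in> {1..N} \<Longrightarrow> g j \<le> h j"
    and nondegenerate:
      "(\<forall>i\<in>{1..M}. 0 < p i N) \<Longrightarrow> g N = 0 \<Longrightarrow> \<exists>t::'a. t \<noteq> 0 \<and> t \<noteq> 1"
    and q1: "\<And>i k j. i \<in> {1..M} \<Longrightarrow> k \<in> {1..M} \<Longrightarrow> j \<in> {1..N-1} \<Longrightarrow>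
      q (M * (i - 1) + k) j =
        (if p i N < 0 \<and> 0 < p k N
         then - ((p i j * p k N - p k j * p i N) / (p i N - p k N)) else 0)"
    and q2: "\<And>i j. i \<in> {1..M} \<Longrightarrow> j \<in> {1..N-1} \<Longrightarrow> q (M\<^sup>2 + i) j = p i j"
    and r: "\<And>i j. i \<in> {1..M} \<Longrightarrow> j \<in> {1..N-1} \<Longrightarrow>
      r i j = (if p i N < 0 then - (p i j / p i N) else 0)"
    and s: "\<And>i j. i \<in> {1..M} \<Longrightarrow> j \<in> {1..N-1} \<Longrightarrow>
      s i j = (if 0 < p i N then p i j / p i N else 0)"
    and b1: "\<And>i k. i \<in> {1..M} \<Longrightarrow> k \<in> {1..M} \<Longrightarrow>
      b (M * (i - 1) + k) =
        (if p i N < 0 \<and> 0 < p k N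
         then a i rpow (- (p k N / (p i N - p k N))) * a k rpow (p i N / (p i N - p k N))
         else 0)"
    and b2: "\<And>i. i \<in> {1..M} \<Longrightarrow> b (M\<^sup>2 + i) = inv_pow_sum (g N) (h N) (p i N) * a i"
    and c: "\<And>i. i \<in> {1..M} \<Longrightarrow>
      c i = (if p i N < 0 then \<mu> rpow (1 / p i N) * a i rpow (- 1 / p i N) else 0)"
    and d: "\<And>i. i \<in> {1..M} \<Longrightarrow>
      d i = (if 0 < p i N then \<mu> rpow (- 1 / p i N) * a i rpow (1 / p i N) else 0)"
  shows "is_arg_min (trop_poly M N a p) (feasible N g h) x \<and> trop_poly M N a p x = \<mu>
    \<longleftrightarrow>
      is_arg_min (trop_poly (M\<^sup>2 + M) (N - 1) b q) (feasible (N - 1) g h) x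
      \<and> trop_poly (M\<^sup>2 + M) (N - 1) b q x = \<mu>
      \<and> x N \<noteq> 0
      \<and> trop_poly M (N - 1) c r x + g N \<le> x N
      \<and> x N \<le> (if \<mu> = 0 \<and> (\<exists>i\<in>{1..M}. 0 < p i N) then 0
               else inverse (trop_poly M (N - 1) d s x + inverse (h N)))"
proof -
  define u where "u y i = a i * (\<Prod>j=1..N-1. y j rpow p i j)" for y :: "nat \<Rightarrow> 'a" and i
  \<comment> \<open>For \<open>\<mu> \<noteq> 0\<close> and \<open>p i N \<noteq> 0\<close> this is
    the value of the last coordinate at which the \<open>i\<close>-th term equals \<mu>.\<close>
  define v where "v y i = (\<mu> * inverse (u y i)) rpow (1 / p i N)" for y i
  let ?F = "trop_poly M N a p" and ?G = "trop_poly (M\<^sup>2 + M) (N - 1) b q"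
  let ?A = "feasible N g h" and ?B = "feasible (N - 1) g h"
  have N: "N \<in> {1..N}" "{1..N} = insert N {1..N-1}" "N \<notin> {1..N-1}"
    using \<open>1 \<le> N\<close> by auto
  have hN: "h N \<noteq> 0" and gN: "g N \<le> h N" using h_nz g_le_h N(1) by blast+
  have A_iff: "?A y \<longleftrightarrow> ?B y \<and> y N \<noteq> 0 \<and> g N \<le> y N \<and> y N \<le> h N" for y
    unfolding feasible_def N(2) by auto
  have B_nz: "y j \<noteq> 0" if "?B y" "j \<in> {1..N-1}" for y j
    using that unfolding feasible_def by blast
  have u_nz: "u y i \<noteq> 0" if "?B y" "i \<in> {1..M}" for y i
  proof -
    have "(\<Prod>j=1..N-1. y j rpow p i j) \<noteq> 0"
      by (intro semifield_prod_nonzero rpow_nonzero B_nz[OF that(1)])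
    then show ?thesis using a_nz[OF that(2)] by (simp add: u_def)
  qed
  have F_eq: "?F y = (\<Sum>i=1..M. u y i * y N rpow p i N)" for y
    unfolding trop_poly_def u_def N(2) using N(3) by (simp add: ac_simps)
  have F_le: "?F y \<le> z \<longleftrightarrow> (\<forall>i\<in>{1..M}. u y i * y N rpow p i N \<le> z)" for y z
    unfolding F_eq by (simp add: sum_le_iff)
  have F_nz: "?F y \<noteq> 0" if "?A y" for y
  proof
    assume "?F y = 0"
    then have "u y 1 * y N rpow p 1 N \<le> 0" using F_le[of y 0] \<open>1 \<le> M\<close> by auto
    then show False using that u_nz[of y 1] \<open>1 \<le> M\<close> by (simp add: A_iff)
  qed

  \<comment> \<open>Terms of the reduced objective\<close>
  have pair_term: "b (M * (i - 1) + k) * (\<Prod>j=1..N-1. y j rpow q (M * (i - 1) + k) j) =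
      (if p i N < 0 \<and> 0 < p k N
       then u y i rpow (- (p k N / (p i N - p k N))) * u y k rpow (p i N / (p i N - p k N)) else 0)"
    if y: "?B y" and ik: "i \<in> {1..M}" "k \<in> {1..M}" for y i k
  proof (cases "p i N < 0 \<and> 0 < p k N")
    case True
    define \<alpha> where "\<alpha> = - (p k N / (p i N - p k N))"
    define \<beta> where "\<beta> = p i N / (p i N - p k N)"
    \<comment> \<open>The exponents are the same weighted combination as the coefficients, so the
      whole term is a weighted geometric mean of \<open>u y i\<close> and
      \<open>u y k\<close>.\<close>
    have "q (M * (i - 1) + k) j = p i j * \<alpha> + p k j * \<beta>" if "j \<in> {1..N-1}" for j
      using q1[OF ik that] True
      by (simp add: \<alpha>_def \<beta>_def diff_divide_distrib)
    then have "(\<Prod>j=1..N-1. y j rpow q (M * (i - 1) + k) j)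
        = (\<Prod>j=1..N-1. y j rpow (p i j * \<alpha>) * y j rpow (p k j * \<beta>))"
      using B_nz[OF y] by (intro prod.cong) (simp_all add: rpow_add)
    moreover have "u y l rpow t = a l rpow t * (\<Prod>j=1..N-1. y j rpow (p l j * t))"
      if "l \<in> {1..M}" for l t
      unfolding u_def using a_nz[OF that] B_nz[OF y] by (rule monomial_rpow)
    ultimately show ?thesis using b1[OF ik] ik True
      by (simp add: prod.distrib ac_simps flip: \<alpha>_def \<beta>_def)
  qed (use b1[OF ik] in auto)
  have single_term: "b (M\<^sup>2 + i) * (\<Prod>j=1..N-1. y j rpow q (M\<^sup>2 + i) j)
      = inv_pow_sum (g N) (h N) (p i N) * u y i" if "i \<in> {1..M}" for y i
    using b2[OF that] q2[OF that] by (simp add: u_def mult.assoc)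
  have G_le: "?G y \<le> z \<longleftrightarrow>
      (\<forall>i\<in>{1..M}. \<forall>k\<in>{1..M}. p i N < 0 \<and> 0 < p k N \<longrightarrow>
        u y i rpow (- (p k N / (p i N - p k N))) * u y k rpow (p i N / (p i N - p k N)) \<le> z)
      \<and> (\<forall>i\<in>{1..M}. inv_pow_sum (g N) (h N) (p i N) * u y i \<le> z)" if "?B y" for y z
  proof -
    have "?G y \<le> z \<longleftrightarrow> (\<forall>l\<in>{1..M\<^sup>2 + M}. b l * (\<Prod>j=1..N-1. y j rpow q l j) \<le> z)"
      unfolding trop_poly_def by (simp add: sum_le_iff)
    then show ?thesis unfolding paired_indices using pair_term[OF that] single_term by auto
  qed

  \<comment> \<open>Comparison of the two objectives\<close>
  have u_upd: "u (y(N := t)) = u y" for y t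
    unfolding u_def using N(3) by (intro ext arg_cong2[where f = "(*)"] prod.cong refl) auto
  have B_upd: "?B (y(N := t)) \<longleftrightarrow> ?B y" for y t
    unfolding feasible_def using N(3) by (intro ball_cong refl) auto
  have elim: "?G y \<le> z \<longleftrightarrow> (\<exists>t. ?A (y(N := t)) \<and> ?F (y(N := t)) \<le> z)"
    if y: "?B y" and z: "z \<noteq> 0" for y z
  proof -
    have "?A (y(N := t)) \<and> ?F (y(N := t)) \<le> z \<longleftrightarrow>
        t \<noteq> 0 \<and> g N \<le> t \<and> t \<le> h N \<and> (\<forall>i\<in>{1..M}. u y i * t rpow p i N \<le> z)" for t
      unfolding A_iff B_upd F_le u_upd using y by simp
    then show ?thesis unfolding G_le[OF y]
      using eliminate_variable[of "{1..M}" "u y" "h N" "g N" z "\<lambda>i. p i N"] u_nz[OF y] hN gN z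
      by simp
  qed
  \<comment> \<open>The level is \<open>?F y\<close> itself, nonzero by \<open>F_nz\<close>, and the
    witness for the eliminated coordinate is \<open>y N\<close>.\<close>
  have G_le_F: "?G y \<le> ?F y" if "?A y" for y
    using elim[of y "?F y"] F_nz[OF that] that A_iff[of y] by (metis fun_upd_triv order_refl)
  have G_zero: "(\<forall>i\<in>{1..M}. 0 < p i N) \<and> g N = 0" if "?B y" "?G y = 0" for y
  proof -
    have "inv_pow_sum (g N) (h N) (p i N) * u y i = 0" if "i \<in> {1..M}" for i
      using G_le[OF \<open>?B y\<close>, of 0] \<open>?G y = 0\<close> that by auto
    then have "0 < p i N \<and> g N = 0" if "i \<in> {1..M}" for i
      using inv_pow_sum_eq_0_iff[OF hN gN] u_nz[OF \<open>?B y\<close> that] that by fastforce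
    then show ?thesis using \<open>1 \<le> M\<close> by auto
  qed

  \<comment> \<open>The degenerate case\<close>
  have no_minimizer: "\<exists>y'. ?A y' \<and> ?F y' < ?F y"
    if deg: "\<forall>i\<in>{1..M}. 0 < p i N" "g N = 0" and y: "?A y" for y
  proof -
    obtain t :: 'a where t: "t \<noteq> 0" "t < 1"
    proof -
      \<comment> \<open>By linearity, either \<open>t\<close> or its inverse lies below
        \<open>1\<close>.\<close>
      obtain t :: 'a where t: "t \<noteq> 0" "t \<noteq> 1" using nondegenerate deg by blast
      show ?thesis
      proof (cases "t < 1")
        case False
        then have "inverse t \<le> 1" using t(1) semifield_le_mult_inverse_iff[of t "inverse t" t]
          semifield_inverse_le_iff[of t 1] by (simp add: semifield_inverse_unique)
        moreover have "inverse t \<noteq> 1" using t mult_inverse[of t] by auto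
        ultimately show ?thesis using that[of "inverse t"] t(1) by simp
      qed (use t that in blast)
    qed
    let ?y = "y(N := t * y N)"
    have nz: "y N \<noteq> 0" "y N \<le> h N" and B: "?B y" using y by (simp_all add: A_iff)
    have "t * y N \<le> y N" using t mult_right_mono[of t 1 "y N"] by simp
    then have "?A ?y" unfolding A_iff B_upd using B t nz deg(2) by simp
    moreover have "\<not> ?F y \<le> ?F ?y"
    proof
      assume le: "?F y \<le> ?F ?y"
      \<comment> \<open>An index attaining the new value gives a comparison of the
        \<open>i\<close>-th term before and after scaling; cancelling \<open>u y i\<close> and the
        positive exponent leaves \<open>y N \<le> t * y N\<close>, contrary to
        \<open>t < 1\<close>.\<close>
      obtain i where i: "i \<in> {1..M}" "?F ?y = u ?y i * ?y N rpow p i N"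
        using sum_attained[of "{1..M}" "\<lambda>i. u ?y i * ?y N rpow p i N"] \<open>1 \<le> M\<close>
        unfolding F_eq by auto
      have "u y i * y N rpow p i N \<le> u ?y i * ?y N rpow p i N"
        using F_le[of y "?F ?y"] le i by simp
      then have "u y i * y N rpow p i N \<le> u y i * (t * y N) rpow p i N" by (simp add: u_upd)
      then have "y N \<le> t * y N"
        using u_nz[OF B i(1)] nz t deg(1) i(1)
        by (simp add: semifield_mult_left_le_iff rpow_le_iff)
      then have "y N * 1 \<le> y N * t" by (simp add: mult.commute)
      then show False using t(2) nz(1) semifield_mult_left_le_iff[of "y N" 1 t] by simp
    qed
    ultimately show ?thesis by (metis not_le)
  qed

  \<comment> \<open>The double inequality as bounds on the last coordinate\<close>
  have c_term: "c i * (\<Prod>j=1..N-1. x j rpow r i j) = (if p i N < 0 then v x i else 0)"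
    if B: "?B x" and \<mu>: "\<mu> \<noteq> 0" and i: "i \<in> {1..M}" for i
  proof (cases "p i N < 0")
    case True
    have "v x i = \<mu> rpow (1 / p i N) * u x i rpow (- 1 / p i N)"
      using u_nz[OF B i] \<mu> by (simp add: v_def rpow_mult_distrib inverse_rpow)
    moreover have "u x i rpow (- 1 / p i N)
        = a i rpow (- 1 / p i N) * (\<Prod>j=1..N-1. x j rpow (p i j * (- 1 / p i N)))"
      unfolding u_def using a_nz[OF i] B_nz[OF B] by (rule monomial_rpow)
    ultimately show ?thesis using True c[OF i] r[OF i] by (simp add: mult.assoc)
  qed (use c[OF i] in simp)
  have d_term: "d i * (\<Prod>j=1..N-1. x j rpow s i j) = (if 0 < p i N then inverse (v x i) else 0)"
    if B: "?B x" and \<mu>: "\<mu> \<noteq> 0" and i: "i \<in> {1..M}" for i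
  proof (cases "0 < p i N")
    case True
    have "inverse (v x i) = (\<mu> * inverse (u x i)) rpow (- (1 / p i N))"
      using u_nz[OF B i] \<mu> by (simp add: v_def rpow_minus)
    also have "\<dots> = \<mu> rpow (- 1 / p i N) * u x i rpow (1 / p i N)"
      using u_nz[OF B i] \<mu> by (simp add: rpow_mult_distrib inverse_rpow)
    moreover have "u x i rpow (1 / p i N)
        = a i rpow (1 / p i N) * (\<Prod>j=1..N-1. x j rpow (p i j * (1 / p i N)))"
      unfolding u_def using a_nz[OF i] B_nz[OF B] by (rule monomial_rpow)
    ultimately show ?thesis using True d[OF i] s[OF i] by (simp add: mult.assoc)
  qed (use d[OF i] in simp)

  have bounds: "trop_poly M (N - 1) c r x + g N \<le> x N
      \<and> x N \<le> inverse (trop_poly M (N - 1) d s x + inverse (h N)) \<longleftrightarrow>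
      g N \<le> x N \<and> x N \<le> h N \<and>
      (\<forall>i\<in>{1..M}. (p i N < 0 \<longrightarrow> v x i \<le> x N) \<and> (0 < p i N \<longrightarrow> x N \<le> v x i))"
    if B: "?B x" and \<mu>: "\<mu> \<noteq> 0" and xN: "x N \<noteq> 0"
  proof -
    have v_nz: "v x i \<noteq> 0" if "i \<in> {1..M}" for i using u_nz[OF B that] \<mu> by (simp add: v_def)
    have "trop_poly M (N - 1) c r x \<le> x N \<longleftrightarrow> (\<forall>i\<in>{1..M}. p i N < 0 \<longrightarrow> v x i \<le> x N)"
      unfolding trop_poly_def using c_term[OF B \<mu>] by (simp add: sum_le_iff)
    moreover have "trop_poly M (N - 1) d s x \<le> inverse (x N)
        \<longleftrightarrow> (\<forall>i\<in>{1..M}. 0 < p i N \<longrightarrow> x N \<le> v x i)"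
      unfolding trop_poly_def using d_term[OF B \<mu>] v_nz xN
      by (auto simp: sum_le_iff semifield_inverse_le_iff)
    \<comment> \<open>The summand \<open>inverse (h N)\<close> keeps the sum nonzero even when no
      exponent is positive, so inversion reverses the order.\<close>
    moreover have "trop_poly M (N - 1) d s x + inverse (h N) \<noteq> 0"
      using hN by simp
    ultimately show ?thesis
      using xN hN
      by (auto simp: add_le_iff semifield_le_inverse_iff[of "x N"] semifield_inverse_le_iff)
  qed
  have F_le_\<mu>: "?A x \<and> ?F x \<le> \<mu> \<longleftrightarrow>
      ?B x \<and> ?G x \<le> \<mu> \<and> x N \<noteq> 0 \<and> trop_poly M (N - 1) c r x + g N \<le> x N
      \<and> x N \<le> inverse (trop_poly M (N - 1) d s x + inverse (h N))"
    if \<mu>: "\<mu> \<noteq> 0"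
  proof (cases "?B x \<and> x N \<noteq> 0")
    case True
    then have B: "?B x" and xN: "x N \<noteq> 0" by blast+
    have F: "?F x \<le> \<mu> \<longleftrightarrow>
        (\<forall>i\<in>{1..M}. (p i N < 0 \<longrightarrow> v x i \<le> x N) \<and> (0 < p i N \<longrightarrow> x N \<le> v x i))
        \<and> (\<forall>i\<in>{1..M}. p i N = 0 \<longrightarrow> u x i \<le> \<mu>)"
      unfolding F_le ball_conj_distrib[symmetric]
    proof (intro ball_cong refl)
      fix i assume i: "i \<in> {1..M}"
      show "u x i * x N rpow p i N \<le> \<mu> \<longleftrightarrow>
          ((p i N < 0 \<longrightarrow> v x i \<le> x N) \<and> (0 < p i N \<longrightarrow> x N \<le> v x i)) \<and> (p i N = 0 \<longrightarrow> u x i \<le> \<mu>)"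
        unfolding mult_rpow_le_iff[OF u_nz[OF B i] xN \<mu>] v_def
        by (cases "p i N" "0 :: rat" rule: linorder_cases) simp_all
    qed
    \<comment> \<open>Terms with exponent \<open>0\<close> do not enter the double inequality; they
      occur with coefficient factor \<open>1\<close> in the reduced objective, which controls
      them.\<close>
    have "inv_pow_sum (g N) (h N) 0 = 1" using inv_pow_sum_cases[OF hN gN, of 0] by simp
    then have "\<forall>i\<in>{1..M}. p i N = 0 \<longrightarrow> u x i \<le> \<mu>" if "?G x \<le> \<mu>"
      using G_le[OF B, of \<mu>] that by (metis mult_1)
    moreover have "?G x \<le> \<mu>" if "?A x" "?F x \<le> \<mu>"
      using G_le_F[OF that(1)] that(2) by (rule order_trans)
    ultimately show ?thesis
      using bounds[OF B \<mu> xN] F A_iff[of x] B xN by blast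
  qed (auto simp: A_iff)

  \<comment> \<open>Transfer of minimizers and minimum values\<close>
  show ?thesis
  proof (cases "\<mu> = 0")
    case True
    \<comment> \<open>For \<open>\<mu> = 0\<close> both sides fail: the original objective is never
      \<open>0\<close>, and on the right a positive exponent makes the upper bound \<open>0\<close>,
      contrary to \<open>x N \<noteq> 0\<close>.\<close>
    have "\<exists>i\<in>{1..M}. 0 < p i N" if "?B x" "?G x = \<mu>"
      using G_zero[of x] that True \<open>1 \<le> M\<close> by auto
    then show ?thesis using True F_nz by (auto simp: is_arg_min_def)
  next
    case \<mu>: False
    have "is_arg_min ?F ?A x \<and> ?F x = \<mu> \<longleftrightarrow>
        is_arg_min ?G ?B x \<and> ?G x = \<mu> \<and> x N \<noteq> 0 \<and> trop_poly M (N - 1) c r x + g N \<le> x N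
        \<and> x N \<le> inverse (trop_poly M (N - 1) d s x + inverse (h N))" (is "?L \<longleftrightarrow> ?R")
    proof
      assume L: ?L
      then have x: "?A x" "?F x = \<mu>" by (simp_all add: is_arg_min_def)
      have min: "\<mu> \<le> ?F y" if "?A y" for y
        using L that by (auto simp: is_arg_min_def not_less)
      have lower: "\<mu> \<le> ?G y" if B: "?B y" for y
      proof -
        \<comment> \<open>A zero of the reduced objective would put the program in the degenerate
          case, where \<open>x\<close> could not be a minimizer. Hence elimination applies at level
          \<open>?G y\<close>.\<close>
        have "?G y \<noteq> 0" using G_zero[OF B] no_minimizer[of x] x min by (meson not_le)
        then obtain t where "?A (y(N := t))" "?F (y(N := t)) \<le> ?G y"
          using elim[OF B, of "?G y"] by auto
        then show ?thesis using min by (meson order_trans)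
      qed
      have R: "?B x \<and> ?G x \<le> \<mu> \<and> x N \<noteq> 0 \<and> trop_poly M (N - 1) c r x + g N \<le> x N
        \<and> x N \<le> inverse (trop_poly M (N - 1) d s x + inverse (h N))"
        using F_le_\<mu>[OF \<mu>] x by simp
      then have "?G x = \<mu>" using lower by (meson order_antisym)
      then have "is_arg_min ?G ?B x" using R lower by (metis is_arg_min_def not_less)
      then show ?R using R \<open>?G x = \<mu>\<close> by blast
    next
      assume R: ?R
      then have x: "?A x" "?F x \<le> \<mu>" using F_le_\<mu>[OF \<mu>] by (auto simp: is_arg_min_def)
      have lower: "\<mu> \<le> ?F y" if "?A y" for y
      proof -
        \<comment> \<open>A point feasible for the original program is feasible for the reduced one,
          so its original value is at least its reduced value, which is at least \<mu>.\<close>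
        have "\<not> ?G y < ?G x" using R that A_iff[of y] unfolding is_arg_min_def by blast
        then have "\<mu> \<le> ?G y" using R by (simp add: not_less)
        then show ?thesis using G_le_F[OF that] by (rule order_trans)
      qed
      then have "?F x = \<mu>" using x by (meson order_antisym)
      moreover have "is_arg_min ?F ?A x" using x lower \<open>?F x = \<mu>\<close> by (metis is_arg_min_def not_less)
      ultimately show ?L by blast
    qed
    then show ?thesis using \<mu> by simp
  qed
qed

end
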